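(* For positive integers $n$, let $\kappa_n$ be the unique positive root of $k^3+k=\frac{n}{2\pi}$ and let $\mathcal U_n=\frac{\sqrt{1+\kappa_n^2}}{\kappa_n}e^{2\pi\kappa_n/n}$. Then $\mathcal U_n$ is strictly decreasing in $n$, and $\lim_{n\to\infty}\mathcal U_n=1$. Moreover, $\kappa_n$ is positive, strictly increasing, and strictly concave in $n$, with $\kappa_n=\Theta(n^{1/3})$.
   Context: Strict concavity in $n$ of the sequence means $\kappa_{n+2}-2\kappa_{n+1}+\kappa_n<0$ for all $n\ge1$. $\kappa_n=\Theta(n^{1/3})$ means that there are constants $0<a\le b$ with $a n^{1/3}\le\kappa_n\le b n^{1/3}$ for all sufficiently large $n$. *)

theory Defs
  imports "HOL-Analysis.Analysis"
begin

lemma cubic_ex1_pos_root: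
  fixes c :: real
  assumes "c > 0"
  shows "\<exists>!k::real. k > 0 \<and> k ^ 3 + k = c"
proof (rule ex_ex1I)
  have "0 ^ 3 + 0 \<le> c" "c \<le> c ^ 3 + c" "0 \<le> c" using assms by simp_all
  moreover have "continuous_on {0..c} (\<lambda>k::real. k ^ 3 + k)"
    by (intro continuous_intros)
  ultimately have "\<exists>k\<ge>0. k \<le> c \<and> k ^ 3 + k = c"
    by (rule IVT'[of "\<lambda>k::real. k ^ 3 + k"])
  then obtain k :: real where k: "k \<ge> 0" "k ^ 3 + k = c" by blast
  have "k \<noteq> 0"
  proof
    assume "k = 0"
    then show False using k(2) assms by simp
  qed
  then have "k > 0" using k(1) by simp
  then show "\<exists>k::real. k > 0 \<and> k ^ 3 + k = c" using k(2) by blast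
next
  fix k l :: real
  assume k: "k > 0 \<and> k ^ 3 + k = c" and l: "l > 0 \<and> l ^ 3 + l = c"
  show "k = l"
  proof (rule linorder_cases[of k l])
    assume "k < l"
    then have "k ^ 3 < l ^ 3" using k by (intro power_strict_mono) simp_all
    then show ?thesis using \<open>k < l\<close> k l by linarith
  next
    assume "l < k"
    then have "l ^ 3 < k ^ 3" using l by (intro power_strict_mono) simp_all
    then show ?thesis using \<open>l < k\<close> k l by linarith
  qed
qed

(* Only meaningful for n \<ge> 1; for n = 0 there is no positive root and the value is unspecified. *)
definition kappa :: "nat \<Rightarrow> real" where
  "kappa n = (THE k. k > 0 \<and> k ^ 3 + k = real n / (2 * pi))"

lemma kappa_unique_root:
  assumes "n \<ge> 1"
  shows "\<exists>!k::real. k > 0 \<and> k ^ 3 + k = real n / (2 * pi)"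
  using assms by (intro cubic_ex1_pos_root) simp

definition U :: "nat \<Rightarrow> real" where
  "U n = sqrt (1 + kappa n ^ 2) / kappa n * exp (2 * pi * kappa n / real n)"

end

theory Submission
  imports Defs "HOL-Real_Asymp.Real_Asymp"
begin

text \<open>Writing \<open>k\<close> for \<open>kappa n\<close>, the cubic equation gives \<open>2 pi k / n = 1 / (1 + k\<^sup>2)\<close>. Hence
  \<open>U n\<close> is a fixed decreasing function of \<open>k\<close> that tends to 1 as \<open>k\<close> tends to infinity. The
  monotonicity and concavity of \<open>kappa\<close> hold because it inverts the map \<open>k \<mapsto> k\<^sup>3 + k\<close>,
  which is increasing and strictly convex for positive \<open>k\<close>, at equally spaced points.\<close>

lemma kappa_pos: "n \<ge> 1 \<Longrightarrow> kappa n > 0"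
  and kappa_eq: "n \<ge> 1 \<Longrightarrow> kappa n ^ 3 + kappa n = real n / (2 * pi)"
  using theI'[OF kappa_unique_root[of n]] unfolding kappa_def by auto

text \<open>The linear term supplies strictness on top of the weak monotonicity of the cube. Stated
  on all reals, it lets the cubic be cancelled from inequalities without sign conditions.\<close>

lemma strict_mono_cubic: "strict_mono (\<lambda>x::real. x ^ 3 + x)"
  by (intro strict_monoI add_le_less_mono power_mono_odd) auto

lemmas cubic_less_iff = strict_mono_less[OF strict_mono_cubic]
  and cubic_le_iff = strict_mono_less_eq[OF strict_mono_cubic]

lemma kappa_strict_mono:
  assumes "1 \<le> m" "m < n"
  shows "kappa m < kappa n"
proof -
  have "kappa m ^ 3 + kappa m < kappa n ^ 3 + kappa n"
    using assms by (simp only: kappa_eq) (simp add: divide_strict_right_mono)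
  then show ?thesis
    by (simp only: cubic_less_iff)
qed

text \<open>The linear terms cancel, and the convexity gap of the cube has the factor
  \<open>(x - y)\<^sup>2\<close>; its sign is therefore that of \<open>x + y\<close>.\<close>

lemma cubic_strict_midpoint_convex:
  fixes x y :: real
  assumes "x \<noteq> y" "x + y > 0"
  shows "2 * (((x + y) / 2) ^ 3 + (x + y) / 2) < (x ^ 3 + x) + (y ^ 3 + y)"
proof -
  have "(x ^ 3 + x) + (y ^ 3 + y) - 2 * (((x + y) / 2) ^ 3 + (x + y) / 2)
      = 3 / 4 * (x + y) * (x - y)\<^sup>2"
    by (simp add: field_simps power2_eq_square power3_eq_cube)
  also have "\<dots> > 0"
    using assms by simp
  finally show ?thesis
    by simp
qed

text \<open>A nonnegative second difference would put the middle value at or below the midpoint of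
  its neighbours; strict convexity of the cubic then contradicts the equal spacing of its
  values.\<close>

lemma kappa_strict_concave:
  assumes "n \<ge> 1"
  shows "kappa (n + 2) - 2 * kappa (n + 1) + kappa n < 0"
proof (rule ccontr)
  let ?m = "(kappa n + kappa (n + 2)) / 2"
  assume "\<not> ?thesis"
  then have "kappa (n + 1) \<le> ?m"
    by simp
  then have "kappa (n + 1) ^ 3 + kappa (n + 1) \<le> ?m ^ 3 + ?m"
    by (simp only: cubic_le_iff)
  then have "2 * (kappa (n + 1) ^ 3 + kappa (n + 1)) \<le> 2 * (?m ^ 3 + ?m)"
    by (rule mult_left_mono) simp
  also have "\<dots> < (kappa n ^ 3 + kappa n) + (kappa (n + 2) ^ 3 + kappa (n + 2))"
    using assms kappa_pos[of n] kappa_pos[of "n + 2"] kappa_strict_mono[of n "n + 2"]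
    by (intro cubic_strict_midpoint_convex) auto
  \<comment> \<open>Both sides equal \<open>(n + 1) / pi\<close>, so the strict inequality is
    absurd.\<close>
  finally have "2 * (real (n + 1) / (2 * pi)) < real n / (2 * pi) + real (n + 2) / (2 * pi)"
    using assms by (simp only: kappa_eq)
  then show False
    by (simp add: field_simps)
qed

lemma kappa_bounds:
  assumes "n \<ge> 1"
  shows "1 / 10 * real n powr (1 / 3) \<le> kappa n" "kappa n \<le> real n powr (1 / 3)"
proof -
  define t where "t = real n powr (1 / 3)"
  have t3: "t ^ 3 = real n"
    using assms by (simp add: t_def powr_powr flip: powr_realpow)
  have t1: "t \<ge> 1"
    using assms by (simp add: t_def ge_one_powr_ge_zero)
  have "kappa n \<le> t"
  proof (rule ccontr)
    assume "\<not> kappa n \<le> t"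
    then have "t ^ 3 + t < real n / (2 * pi)"
      \<comment> \<open>Read backwards, \<open>kappa_eq\<close> turns the right-hand side into the
        cubic at \<open>kappa n\<close>, leaving \<open>t < kappa n\<close>.\<close>
      using assms by (simp only: cubic_less_iff not_le flip: kappa_eq)
    also have "\<dots> \<le> t ^ 3"
      unfolding t3 using pi_gt3 divide_left_mono[of 1 "2 * pi" "real n"] by simp
    finally show False
      using t1 by simp
  qed
  then show "kappa n \<le> real n powr (1 / 3)"
    by (simp add: t_def)
  have "t / 10 \<le> kappa n"
  proof (rule ccontr)
    assume "\<not> t / 10 \<le> kappa n"
    then have "real n / (2 * pi) < (t / 10) ^ 3 + t / 10"
      using assms by (simp only: cubic_less_iff not_le flip: kappa_eq)
    \<comment> \<open>Since \<open>t \<le> t ^ 3\<close>, the left side is at most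
      \<open>(1/1000 + 1/10) * t ^ 3\<close>. The constant 1/10 keeps this below 1/8, which in turn
      is below \<open>1 / (2 * pi)\<close> because \<open>pi < 4\<close>.\<close>
    also have "\<dots> \<le> t ^ 3 / 8"
      using t1 power_increasing[of 1 3 t] by (simp add: power_divide)
    also have "\<dots> \<le> real n / (2 * pi)"
      unfolding t3 using pi_less_4 by (intro divide_left_mono) auto
    finally show False
      by simp
  qed
  then show "1 / 10 * real n powr (1 / 3) \<le> kappa n"
    by (simp add: t_def)
qed

lemma filterlim_kappa_at_top: "filterlim kappa at_top sequentially"
proof (rule filterlim_at_top_mono)
  show "filterlim (\<lambda>n. 1 / 10 * real n powr (1 / 3)) at_top sequentially"
    by real_asymp
  show "\<forall>\<^sub>F n in sequentially. 1 / 10 * real n powr (1 / 3) \<le> kappa n"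
    using eventually_ge_at_top[of 1] by eventually_elim (rule kappa_bounds)
qed

text \<open>Factoring the cubic as \<open>k * (1 + k ^ 2)\<close> eliminates \<open>n\<close> from
  the exponent. Both resulting factors are positive, decrease as \<open>kappa n\<close> grows, and
  tend to 1.\<close>

lemma U_eq:
  assumes "n \<ge> 1"
  shows "U n = sqrt (1 + 1 / kappa n ^ 2) * exp (1 / (1 + kappa n ^ 2))"
proof -
  let ?k = "kappa n"
  have k: "?k > 0"
    using assms by (rule kappa_pos)
  have n: "real n = 2 * pi * (?k * (1 + ?k ^ 2))"
    using kappa_eq[OF assms] by (simp add: field_simps power2_eq_square power3_eq_cube)
  have "2 * pi * ?k / real n = 1 / (1 + ?k ^ 2)"
    unfolding n using k by simp
  moreover have "sqrt (1 + ?k ^ 2) / ?k = sqrt ((1 + ?k ^ 2) / ?k ^ 2)"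
    using k by (simp add: real_sqrt_divide)
  moreover have "(1 + ?k ^ 2) / ?k ^ 2 = 1 + 1 / ?k ^ 2"
    using k by (simp add: field_simps)
  ultimately show ?thesis
    by (simp add: U_def)
qed

lemma U_strict_antimono:
  assumes "1 \<le> m" "m < n"
  shows "U n < U m"
proof -
  have k: "0 < kappa m" "kappa m < kappa n"
    using assms by (auto intro: kappa_pos kappa_strict_mono)
  then have sq: "kappa m ^ 2 < kappa n ^ 2"
    by (intro power_strict_mono) auto
  have "sqrt (1 + 1 / kappa n ^ 2) < sqrt (1 + 1 / kappa m ^ 2)"
    using k sq by (simp add: divide_strict_left_mono)
  moreover have "exp (1 / (1 + kappa n ^ 2)) < exp (1 / (1 + kappa m ^ 2))"
    using sq by (simp add: divide_strict_left_mono add_pos_nonneg)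
  ultimately show ?thesis
    using assms by (simp only: U_eq) (intro mult_strict_mono, auto intro: add_pos_nonneg)
qed

lemma U_tendsto_1: "U \<longlonglongrightarrow> 1"
proof -
  have "((\<lambda>x::real. sqrt (1 + 1 / x ^ 2) * exp (1 / (1 + x ^ 2))) \<longlongrightarrow> 1) at_top"
    by real_asymp
  from filterlim_compose[OF this filterlim_kappa_at_top] show ?thesis
    \<comment> \<open>The closed form is available only from \<open>n = 1\<close> on, so the limit
      is transferred along eventual equality.\<close>
    by (rule Lim_transform_eventually)
      (use eventually_ge_at_top[of 1] in \<open>eventually_elim, simp add: U_eq\<close>)
qed

theorem proposition1:
  shows "strict_antimono_on {1..} U
    \<and> U \<longlonglongrightarrow> 1
    \<and> (\<forall>n\<ge>1. kappa n > 0)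
    \<and> strict_mono_on {1..} kappa
    \<and> (\<forall>n\<ge>1. kappa (n + 2) - 2 * kappa (n + 1) + kappa n < 0)
    \<and> (\<exists>a b :: real. 0 < a \<and> a \<le> b \<and>
          (\<forall>\<^sub>F n in sequentially.
             a * real n powr (1 / 3) \<le> kappa n \<and> kappa n \<le> b * real n powr (1 / 3)))"
proof (intro conjI)
  show "strict_antimono_on {1..} U"
    by (auto intro!: monotone_onI U_strict_antimono)
  show "U \<longlonglongrightarrow> 1"
    by (rule U_tendsto_1)
  show "\<forall>n\<ge>1. kappa n > 0"
    by (simp add: kappa_pos)
  show "strict_mono_on {1..} kappa"
    by (auto intro!: monotone_onI kappa_strict_mono)
  show "\<forall>n\<ge>1. kappa (n + 2) - 2 * kappa (n + 1) + kappa n < 0"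
    using kappa_strict_concave by blast
  have "\<forall>\<^sub>F n in sequentially.
      1 / 10 * real n powr (1 / 3) \<le> kappa n \<and> kappa n \<le> 1 * real n powr (1 / 3)"
    using eventually_ge_at_top[of 1] by eventually_elim (use kappa_bounds in simp)
  then show "\<exists>a b :: real. 0 < a \<and> a \<le> b \<and>
          (\<forall>\<^sub>F n in sequentially.
             a * real n powr (1 / 3) \<le> kappa n \<and> kappa n \<le> b * real n powr (1 / 3))"
    by (intro exI[of _ "1 / 10"] exI[of _ 1]) simp
qed

end
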